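(* Suppose that a Borel measure $\mu$ on $S^{n-1}$ is Aleksandrov related to a Borel measure $\lambda$ on $S^{n-1}$. Then $\mu$ is weakly Aleksandrov related to $\lambda$.
   Context: A set $\omega\subset S^{n-1}$ is spherically convex if $\operatorname{cone}\omega=\{tu:t\ge0,\ u\in\omega\}$ is a nonempty, proper, convex subset of $\mathbb R^n$; in particular a spherically convex set is always nonempty and contained in a closed hemisphere. Its polar set is $\omega^*=\bigcap_{u\in\omega}\{v\in S^{n-1}:u\cdot v\le0\}$. Aleksandrov relation: Borel measures $\mu$ and $\lambda$ on $S^{n-1}$ are Aleksandrov related if $\lambda(S^{n-1})=\mu(S^{n-1})>\mu(\omega)+\lambda(\omega^* )$ for each compact, spherically convex set $\omega\subset S^{n-1}$. For a closed set $\omega\subset S^{n-1}$ and $\beta\in(0,\frac\pi2]$, $\omega_\beta=\bigcup_{u\in\omega}\{v\in S^{n-1}:u\cdot v>\cos\beta\}$. Weak Aleksandrov relation: $\mu$ is weakly Aleksandrov related to $\lambda$ if $\mu(S^{n-1})=\lambda(S^{n-1})$ and for each closed set $\omega\subset S^{n-1}$ contained in a closed hemisphere there exists $\alpha\in(0,\frac\pi2)$ such that $\mu(\omega)\le\lambda(\omega_{\frac\pi2-\alpha})$. Here $\mu$ is not assumed to be discrete. *)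

theory Defs
  imports "HOL-Analysis.Analysis"
begin

abbreviation unit_sphere :: "(real ^ 'n) set" where
  "unit_sphere \<equiv> sphere 0 1"

definition borel_measure_on_sphere :: "(real ^ 'n) measure \<Rightarrow> bool" where
  "borel_measure_on_sphere \<mu> \<longleftrightarrow>
     space \<mu> = unit_sphere \<and> sets \<mu> = sets (restrict_space borel unit_sphere)"

definition cone_over :: "(real ^ 'n) set \<Rightarrow> (real ^ 'n) set" where
  "cone_over \<omega> = {t *\<^sub>R u | t u. t \<ge> 0 \<and> u \<in> \<omega>}"

definition spherically_convex :: "(real ^ 'n) set \<Rightarrow> bool" where
  "spherically_convex \<omega> \<longleftrightarrow>
     \<omega> \<subseteq> unit_sphere \<and>
     cone_over \<omega> \<noteq> {} \<and> cone_over \<omega> \<subset> UNIV \<and> convex (cone_over \<omega>)"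

(* The intersection over u in \<omega> is taken inside the sphere; this only matters for
   \<omega> = {}, which is not spherically convex. *)
definition polar_set :: "(real ^ 'n) set \<Rightarrow> (real ^ 'n) set" where
  "polar_set \<omega> = {v \<in> unit_sphere. \<forall>u\<in>\<omega>. u \<bullet> v \<le> 0}"

(* The values are extended nonnegative reals: finiteness of the measures is not assumed. *)
definition aleksandrov_related ::
    "(real ^ 'n) measure \<Rightarrow> (real ^ 'n) measure \<Rightarrow> bool" where
  "aleksandrov_related \<mu> \<nu> \<longleftrightarrow>
     emeasure \<nu> unit_sphere = emeasure \<mu> unit_sphere \<and>
     (\<forall>\<omega>. compact \<omega> \<and> spherically_convex \<omega> \<longrightarrow>
        emeasure \<mu> unit_sphere > emeasure \<mu> \<omega> + emeasure \<nu> (polar_set \<omega>))"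

definition outer_parallel :: "(real ^ 'n) set \<Rightarrow> real \<Rightarrow> (real ^ 'n) set" where
  "outer_parallel \<omega> \<beta> = (\<Union>u\<in>\<omega>. {v \<in> unit_sphere. u \<bullet> v > cos \<beta>})"

definition closed_hemisphere :: "(real ^ 'n) set \<Rightarrow> bool" where
  "closed_hemisphere H \<longleftrightarrow> (\<exists>w\<in>unit_sphere. H = {v \<in> unit_sphere. w \<bullet> v \<ge> 0})"

definition weakly_aleksandrov_related ::
    "(real ^ 'n) measure \<Rightarrow> (real ^ 'n) measure \<Rightarrow> bool" where
  "weakly_aleksandrov_related \<mu> \<nu> \<longleftrightarrow>
     emeasure \<mu> unit_sphere = emeasure \<nu> unit_sphere \<and>
     (\<forall>\<omega>. closed \<omega> \<and> (\<exists>H. closed_hemisphere H \<and> \<omega> \<subseteq> H) \<longrightarrow>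
        (\<exists>\<alpha>. 0 < \<alpha> \<and> \<alpha> < pi / 2 \<and>
           emeasure \<mu> \<omega> \<le> emeasure \<nu> (outer_parallel \<omega> (pi / 2 - \<alpha>))))"

end

theory Submission
  imports Defs
begin

text \<open>
  The idea is to test the Aleksandrov relation on the closed spherical convex hull of \<open>\<omega>\<close>,
  obtained here as the bipolar \<open>polar_set (polar_set \<omega>)\<close>. For a nonempty \<open>\<omega>\<close> in a closed
  hemisphere the bipolar is compact and spherically convex
  (\<open>spherically_convex_polar_set\<close>), it contains \<open>\<omega>\<close>, and it has the same polar set as \<open>\<omega>\<close>
  (\<open>polar_set_triple\<close>). Hence
  \<open>\<mu>(\<omega>) + \<nu>(\<omega>\<^sup>*) < \<mu>(S) = \<nu>(S) = \<nu>(\<omega>\<^sup>*) + \<nu>(S - \<omega>\<^sup>*)\<close>.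
  Adding \<open>\<nu>(\<omega>\<^sup>*)\<close> preserves \<open>\<le>\<close>, so a strict inequality between the sums gives
  \<open>\<mu>(\<omega>) < \<nu>(S - \<omega>\<^sup>*)\<close>, for measures of infinite total mass as well.

  The set \<open>S - \<omega>\<^sup>*\<close> consists of the points at spherical distance less than \<open>\<pi>/2\<close> from
  \<open>\<omega>\<close>. It is the increasing union of the parallel sets of radius \<open>\<pi>/2 - \<alpha>\<close> as
  \<open>\<alpha>\<close> decreases to \<open>0\<close> (\<open>UN_outer_parallel\<close>). By continuity of \<open>\<nu>\<close> from below the strict
  inequality already holds for one of them.
\<close>

section \<open>Polar sets\<close>

lemma polar_set_antimono: "A \<subseteq> B \<Longrightarrow> polar_set B \<subseteq> polar_set A"
  by (auto simp: polar_set_def)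

lemma subset_polar_set_polar_set:
  "A \<subseteq> unit_sphere \<Longrightarrow> A \<subseteq> polar_set (polar_set A)"
  by (auto simp: polar_set_def inner_commute)

lemma polar_set_triple:
  assumes "A \<subseteq> unit_sphere"
  shows "polar_set (polar_set (polar_set A)) = polar_set A"
proof
  show "polar_set (polar_set (polar_set A)) \<subseteq> polar_set A"
    by (intro polar_set_antimono subset_polar_set_polar_set assms)
  show "polar_set A \<subseteq> polar_set (polar_set (polar_set A))"
    by (rule subset_polar_set_polar_set) (auto simp: polar_set_def)
qed

lemma polar_set_eq_INT:
  "polar_set A = unit_sphere \<inter> (\<Inter>u\<in>A. {v. u \<bullet> v \<le> 0})"
  by (auto simp: polar_set_def)

lemma compact_polar_set: "compact (polar_set A)"
  unfolding polar_set_eq_INT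
  by (intro compact_Int_closed closed_INT ballI closed_halfspace_le compact_sphere)

text \<open>
  Nonemptiness of the polar set is what puts the origin into the cone on the left.
\<close>

lemma cone_over_polar_set:
  fixes A :: "(real ^ 'n) set"
  assumes "polar_set A \<noteq> {}"
  shows "cone_over (polar_set A) = {x. \<forall>a\<in>A. a \<bullet> x \<le> 0}"
proof
  show "cone_over (polar_set A) \<subseteq> {x. \<forall>a\<in>A. a \<bullet> x \<le> 0}"
    by (auto simp: cone_over_def polar_set_def mult_nonneg_nonpos)
  show "{x. \<forall>a\<in>A. a \<bullet> x \<le> 0} \<subseteq> cone_over (polar_set A)"
  proof
    fix x assume x: "x \<in> {x. \<forall>a\<in>A. a \<bullet> x \<le> 0}"
    show "x \<in> cone_over (polar_set A)"
    proof (cases "x = 0")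
      case True
      obtain p where "p \<in> polar_set A"
        using assms by blast
      then have "0 *\<^sub>R p \<in> cone_over (polar_set A)"
        unfolding cone_over_def by blast
      with True show ?thesis by simp
    next
      case False
      have "sgn x \<in> polar_set A"
        using x False
        by (auto simp: polar_set_def norm_sgn sgn_div_norm mult_nonneg_nonpos)
      moreover have "x = norm x *\<^sub>R sgn x"
        using False by (simp add: sgn_div_norm)
      ultimately show ?thesis
        unfolding cone_over_def using norm_ge_zero by blast
    qed
  qed
qed

text \<open>
  The cone over a polar set is an intersection of half-spaces. It is proper because it omits
  every element of \<open>A\<close>.
\<close>

lemma spherically_convex_polar_set:
  fixes A :: "(real ^ 'n) set"
  assumes "A \<subseteq> unit_sphere" "A \<noteq> {}" "polar_set A \<noteq> {}"
  shows "spherically_convex (polar_set A)"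
proof -
  obtain a where a: "a \<in> A"
    using assms(2) by blast
  with assms(1) have "a \<noteq> 0" by auto
  with a have "a \<notin> {x. \<forall>a\<in>A. a \<bullet> x \<le> 0}"
    by (auto intro!: bexI[of _ a] simp: not_le)
  moreover have "0 \<in> {x. \<forall>a\<in>A. a \<bullet> x \<le> 0}"
    by simp
  moreover have "convex {x. \<forall>a\<in>A. a \<bullet> x \<le> 0}"
    by (simp add: Collect_ball_eq convex_INT convex_halfspace_le)
  moreover have "polar_set A \<subseteq> unit_sphere"
    by (auto simp: polar_set_def)
  ultimately show ?thesis
    unfolding spherically_convex_def cone_over_polar_set[OF assms(3)] by blast
qed

section \<open>Parallel sets exhaust the complement of the polar set\<close>

lemma outer_parallel_subset_sphere: "outer_parallel \<omega> \<beta> \<subseteq> unit_sphere"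
  by (auto simp: outer_parallel_def)

lemma outer_parallel_mono:
  assumes "0 \<le> \<beta>" "\<beta> \<le> \<gamma>" "\<gamma> \<le> pi"
  shows "outer_parallel \<omega> \<beta> \<subseteq> outer_parallel \<omega> \<gamma>"
proof -
  have "cos \<gamma> \<le> cos \<beta>"
    using assms by (intro cos_monotone_0_pi_le) auto
  then show ?thesis
    by (force simp: outer_parallel_def)
qed

lemma inverse_Suc_less_pi_half: "1 / Suc k < pi / 2"
proof -
  have "1 / Suc k \<le> 1"
    by simp
  then show ?thesis
    using pi_gt3 by linarith
qed

lemma UN_outer_parallel:
  "(\<Union>k::nat. outer_parallel \<omega> (pi / 2 - 1 / Suc k)) = unit_sphere - polar_set \<omega>"
proof (intro equalityI subsetI)
  fix v assume "v \<in> (\<Union>k::nat. outer_parallel \<omega> (pi / 2 - 1 / Suc k))"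
  then obtain k :: nat and u where v: "u \<in> \<omega>" "norm v = 1" "cos (pi / 2 - 1 / Suc k) < u \<bullet> v"
    by (auto simp: outer_parallel_def)
  have "0 \<le> 1 / real (Suc k)"
    by simp
  then have "0 \<le> cos (pi / 2 - 1 / Suc k)"
    using inverse_Suc_less_pi_half[of k] pi_gt_zero by (intro cos_ge_zero) linarith+
  with v show "v \<in> unit_sphere - polar_set \<omega>"
    by (force simp: polar_set_def)
next
  fix v assume "v \<in> unit_sphere - polar_set \<omega>"
  then obtain u where v: "norm v = 1" "u \<in> \<omega>" "0 < u \<bullet> v"
    by (auto simp: polar_set_def not_le)
  then obtain k :: nat where k: "1 / Suc k < u \<bullet> v"
    using reals_Archimedean by (auto simp: inverse_eq_divide)
  have "cos (pi / 2 - 1 / Suc k) = sin (1 / Suc k)"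
    by (simp add: cos_diff)
  also have "\<dots> \<le> 1 / Suc k"
    by (intro sin_x_le_x) simp
  also note k
  finally show "v \<in> (\<Union>k::nat. outer_parallel \<omega> (pi / 2 - 1 / Suc k))"
    using v by (auto simp: outer_parallel_def)
qed

section \<open>Measurability\<close>

lemma borel_subset_in_sets_sphere:
  assumes "borel_measure_on_sphere \<mu>" "B \<in> sets borel"
  shows "unit_sphere \<inter> B \<in> sets \<mu>"
  using assms by (auto simp: borel_measure_on_sphere_def sets_restrict_space)

lemma closed_in_sets_sphere:
  assumes "borel_measure_on_sphere \<mu>" "closed B" "B \<subseteq> unit_sphere"
  shows "B \<in> sets \<mu>"
  using borel_subset_in_sets_sphere[OF assms(1), of B] assms(2,3)
  by (simp add: Int_absorb1)

lemma outer_parallel_in_sets_sphere: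
  assumes "borel_measure_on_sphere \<mu>"
  shows "outer_parallel \<omega> \<beta> \<in> sets \<mu>"
proof -
  have "outer_parallel \<omega> \<beta> = unit_sphere \<inter> (\<Union>u\<in>\<omega>. {v. u \<bullet> v > cos \<beta>})"
    by (auto simp: outer_parallel_def)
  moreover have "open (\<Union>u\<in>\<omega>. {v. u \<bullet> v > cos \<beta>})"
    by (intro open_UN ballI open_halfspace_gt)
  ultimately show ?thesis
    using borel_subset_in_sets_sphere[OF assms] by simp
qed

text \<open>Continuity of the measure from below, applied to the parallel sets.\<close>

lemma emeasure_less_outer_parallel:
  assumes \<nu>: "borel_measure_on_sphere \<nu>"
    and less: "c < emeasure \<nu> (unit_sphere - polar_set \<omega>)"
  obtains \<alpha> where "0 < \<alpha>" "\<alpha> < pi / 2" "c < emeasure \<nu> (outer_parallel \<omega> (pi / 2 - \<alpha>))"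
proof -
  define P where "P k = outer_parallel \<omega> (pi / 2 - 1 / Suc k)" for k :: nat
  have "incseq P"
  proof (rule incseq_SucI)
    fix k :: nat
    have "1 / real (Suc (Suc k)) \<le> 1 / Suc k"
      by (simp add: field_simps)
    moreover have "0 \<le> 1 / real (Suc (Suc k))"
      by simp
    ultimately show "P k \<subseteq> P (Suc k)"
      unfolding P_def using inverse_Suc_less_pi_half[of k] pi_gt_zero
      by (intro outer_parallel_mono) linarith+
  qed
  moreover have "range P \<subseteq> sets \<nu>"
    by (auto simp: P_def intro: outer_parallel_in_sets_sphere[OF \<nu>])
  ultimately have "(SUP k. emeasure \<nu> (P k)) = emeasure \<nu> (unit_sphere - polar_set \<omega>)"
    using SUP_emeasure_incseq[of P \<nu>] UN_outer_parallel[of \<omega>] by (simp add: P_def)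
  with less obtain k where "c < emeasure \<nu> (P k)"
    by (metis less_SUP_iff)
  then show thesis
    using that[of "1 / Suc k"] inverse_Suc_less_pi_half[of k] by (simp add: P_def)
qed

section \<open>The Aleksandrov relation implies the weak one\<close>

text \<open>
  The Aleksandrov inequality extends from spherically convex sets to arbitrary nonempty
  subsets of a closed hemisphere: passing to the bipolar enlarges \<open>\<omega>\<close> but keeps its polar set. The
  hemisphere provides a point of the polar set, the pole opposite to its centre, and this is
  what keeps the bipolar spherically convex.
\<close>

lemma aleksandrov_related_subset_hemisphere:
  assumes \<mu>: "borel_measure_on_sphere \<mu>"
    and rel: "aleksandrov_related \<mu> \<nu>"
    and H: "closed_hemisphere H" "\<omega> \<subseteq> H" and "\<omega> \<noteq> {}"
  shows "emeasure \<mu> \<omega> + emeasure \<nu> (polar_set \<omega>) < emeasure \<mu> unit_sphere"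
proof -
  obtain w where w: "norm w = 1" "H = {v \<in> unit_sphere. w \<bullet> v \<ge> 0}"
    using H(1) by (auto simp: closed_hemisphere_def)
  have \<omega>: "\<omega> \<subseteq> unit_sphere"
    using H(2) w by auto
  have "- w \<in> polar_set \<omega>"
    using H(2) w by (auto simp: polar_set_def inner_commute)
  let ?K = "polar_set (polar_set \<omega>)"
  have "\<omega> \<subseteq> ?K"
    by (rule subset_polar_set_polar_set[OF \<omega>])
  have "spherically_convex ?K"
  proof (rule spherically_convex_polar_set)
    show "polar_set \<omega> \<subseteq> unit_sphere" by (auto simp: polar_set_def)
    show "polar_set \<omega> \<noteq> {}" using \<open>- w \<in> polar_set \<omega>\<close> by blast
    show "?K \<noteq> {}" using \<open>\<omega> \<subseteq> ?K\<close> \<open>\<omega> \<noteq> {}\<close> by blast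
  qed
  then have "emeasure \<mu> ?K + emeasure \<nu> (polar_set ?K) < emeasure \<mu> unit_sphere"
    using rel compact_polar_set unfolding aleksandrov_related_def by blast
  moreover have "emeasure \<mu> \<omega> \<le> emeasure \<mu> ?K"
  proof (rule emeasure_mono[OF \<open>\<omega> \<subseteq> ?K\<close>])
    show "?K \<in> sets \<mu>"
      by (rule closed_in_sets_sphere[OF \<mu> compact_imp_closed[OF compact_polar_set]])
        (auto simp: polar_set_def)
  qed
  ultimately show ?thesis
    unfolding polar_set_triple[OF \<omega>] by (meson add_right_mono le_less_trans)
qed

theorem proposition3p3:
  fixes \<mu> \<nu> :: "(real ^ 'n) measure"
  assumes "borel_measure_on_sphere \<mu>"
    and "borel_measure_on_sphere \<nu>"
    and "aleksandrov_related \<mu> \<nu>"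
  shows "weakly_aleksandrov_related \<mu> \<nu>"
  unfolding weakly_aleksandrov_related_def
proof (intro conjI allI impI)
  show total: "emeasure \<mu> unit_sphere = emeasure \<nu> unit_sphere"
    using assms(3) by (simp add: aleksandrov_related_def)
  fix \<omega> :: "(real ^ 'n) set"
  assume "closed \<omega> \<and> (\<exists>H. closed_hemisphere H \<and> \<omega> \<subseteq> H)"
  then obtain H where H: "closed_hemisphere H" "\<omega> \<subseteq> H"
    by blast
  show "\<exists>\<alpha>. 0 < \<alpha> \<and> \<alpha> < pi / 2 \<and>
    emeasure \<mu> \<omega> \<le> emeasure \<nu> (outer_parallel \<omega> (pi / 2 - \<alpha>))"
  proof (cases "\<omega> = {}")
    case True
    then show ?thesis
      using pi_gt3 by (intro exI[of _ 1]) simp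
  next
    case False
    let ?P = "polar_set \<omega>"
    have "?P \<in> sets \<nu>"
      by (rule closed_in_sets_sphere[OF assms(2) compact_imp_closed[OF compact_polar_set]])
        (auto simp: polar_set_def)
    moreover have "unit_sphere - ?P \<in> sets \<nu>"
      using sets.compl_sets[OF \<open>?P \<in> sets \<nu>\<close>] assms(2)
      by (simp add: borel_measure_on_sphere_def)
    moreover have "?P \<union> (unit_sphere - ?P) = unit_sphere"
      by (auto simp: polar_set_def)
    ultimately have "emeasure \<nu> unit_sphere = emeasure \<nu> ?P + emeasure \<nu> (unit_sphere - ?P)"
      using plus_emeasure[of ?P \<nu> "unit_sphere - ?P"] by simp
    then have "emeasure \<nu> ?P + emeasure \<mu> \<omega> < emeasure \<nu> ?P + emeasure \<nu> (unit_sphere - ?P)"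
      using aleksandrov_related_subset_hemisphere[OF assms(1,3) H False] total
      by (simp add: add.commute)
    then have "emeasure \<mu> \<omega> < emeasure \<nu> (unit_sphere - ?P)"
      by (meson add_left_mono not_le)
    then show ?thesis
      using emeasure_less_outer_parallel[OF assms(2)] by (metis less_imp_le)
  qed
qed

end
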